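(* Let $C=(C_n)_{n\in\omega}$ be a row-finite $\omega\times\omega$ matrix over a field $\mathcal F$, and let $L^{(n)}_k$ ($n\ge k\ge 0$) be the row vectors generated from $C$ by the infinite Gauss-Jordan algorithm with rightmost pivots. For every $k\in\omega$ there exists $M_k\in\omega$ with $M_k\ge k$ such that $$L^{(n)}_k=L^{(M_k)}_k\quad\text{for all } n>M_k .$$
   Context: $\omega=\{0,1,2,\dots\}$. $\mathcal F$ is a field and $\mathcal F^{(\omega)}$ is the space of sequences $(a_i)_{i\in\omega}$ in $\mathcal F$ with finitely many nonzero terms. A row-finite $\omega\times\omega$ matrix is a sequence $C=(C_n)_{n\in\omega}$ of rows $C_n\in\mathcal F^{(\omega)}$. For nonzero $x\in\mathcal F^{(\omega)}$ the length $\ell(x)$ is the largest index $i$ with $x_i\ne0$; $\ell(\mathbf 0)=-1$. Infinite Gauss-Jordan algorithm with rightmost pivots applied to $C$. It produces vectors $L^{(i)}_n\in\mathcal F^{(\omega)}$ (entries $l^{(i)}_{nj}$) for $n\in\omega$, $i\ge -1$, and $G_n=L^{(n)}_n$, stage by stage for $n=0,1,2,\dots$. Stage $n$ uses the vectors $L^{(n-1)}_0,\dots,L^{(n-1)}_{n-1}$ of the previous stage: (1) Gaussian elimination: $L^{(-1)}_n=C_n$; for $i=0,1,\dots,n-1$ in this order, $L^{(i)}_n=L^{(i-1)}_n-l^{(i-1)}_{n\rho_i}L^{(n-1)}_i$ with $\rho_i=\ell(L^{(n-1)}_i)$ if $L^{(n-1)}_i\ne\mathbf 0$, and $L^{(i)}_n=L^{(i-1)}_n$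 if $L^{(n-1)}_i=\mathbf 0$. (2) Normalization: $L^{(n)}_n=G_n$, where $G_n$ is $L^{(n-1)}_n$ divided by its rightmost nonzero entry if $L^{(n-1)}_n\neq\mathbf 0$, and $G_n=\mathbf 0$ otherwise. (3) Jordan elimination: for $0\le i\le n-1$, $L^{(n)}_i=L^{(n-1)}_i-l^{(n-1)}_{i\rho_n}G_n$ with $\rho_n=\ell(G_n)$ if $G_n\neq\mathbf 0$, and $L^{(n)}_i=L^{(n-1)}_i$ if $G_n=\mathbf 0$. *)

theory Defs
  imports Main "HOL-Library.Poly_Mapping"
begin

text \<open>The space of finitely supported sequences over a field is the type
  \<open>nat \<Rightarrow>\<^sub>0 'a\<close>, so a row-finite matrix is a function \<open>nat \<Rightarrow> nat \<Rightarrow>\<^sub>0 'a\<close>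
  from row indices to rows.\<close>

definition row_length :: "(nat \<Rightarrow>\<^sub>0 'a::zero) \<Rightarrow> int" where
  "row_length x = (if x = 0 then - 1 else int (Max (Poly_Mapping.keys x)))"

definition pivot :: "(nat \<Rightarrow>\<^sub>0 'a::zero) \<Rightarrow> nat" where
  "pivot x = nat (row_length x)"  \<comment> \<open>only used for \<open>x \<noteq> 0\<close>\<close>

definition scale :: "'a::field \<Rightarrow> (nat \<Rightarrow>\<^sub>0 'a) \<Rightarrow> (nat \<Rightarrow>\<^sub>0 'a)" where
  "scale c x = Poly_Mapping.map (\<lambda>a. c * a) x"

definition clear_pivot :: "(nat \<Rightarrow>\<^sub>0 'a::field) \<Rightarrow> (nat \<Rightarrow>\<^sub>0 'a) \<Rightarrow> (nat \<Rightarrow>\<^sub>0 'a)" where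
  "clear_pivot p x =
     (if p = 0 then x else x - scale (Poly_Mapping.lookup x (pivot p)) p)"

definition normalize_row :: "(nat \<Rightarrow>\<^sub>0 'a::field) \<Rightarrow> (nat \<Rightarrow>\<^sub>0 'a)" where
  "normalize_row x =
     (if x = 0 then 0 else scale (inverse (Poly_Mapping.lookup x (pivot x))) x)"

text \<open>The upper index of \<open>L\<^sup>(\<^sup>i\<^sup>)\<^sub>n\<close> starts at \<open>-1\<close>; it is shifted by one here:
  \<open>gj_aux C (Suc i) n\<close> is \<open>L\<^sup>(\<^sup>i\<^sup>)\<^sub>n\<close> and \<open>gj_aux C 0 n\<close> is \<open>L\<^sup>(\<^sup>-\<^sup>1\<^sup>)\<^sub>n = C\<^sub>n\<close>.
  The case \<open>i < n\<close> is Gaussian elimination in stage \<open>n\<close>, whose pivot row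
  \<open>L\<^sup>(\<^sup>n\<^sup>-\<^sup>1\<^sup>)\<^sub>i\<close> is \<open>gj_aux C n i\<close>; the case \<open>i = n\<close> is normalization; the case \<open>i > n\<close>
  is the Jordan elimination of row \<open>n\<close> in stage \<open>i\<close>, whose pivot row
  \<open>G\<^sub>i = L\<^sup>(\<^sup>i\<^sup>)\<^sub>i\<close> is \<open>gj_aux C (Suc i) i\<close>.\<close>

function gj_aux :: "(nat \<Rightarrow> nat \<Rightarrow>\<^sub>0 'a::field) \<Rightarrow> nat \<Rightarrow> nat \<Rightarrow> (nat \<Rightarrow>\<^sub>0 'a)" where
  "gj_aux C 0 n = C n"
| "gj_aux C (Suc i) n =
     (if i < n then clear_pivot (gj_aux C n i) (gj_aux C i n)
      else if i = n then normalize_row (gj_aux C n n)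
      else clear_pivot (gj_aux C (Suc i) i) (gj_aux C i n))"
  by pat_completeness auto
termination
  \<comment> \<open>first by stage, then by position within the stage\<close>
  by (relation "measures [\<lambda>(C, s, n). max n (s - 1), \<lambda>(C, s, n). if s \<le> Suc n then s else Suc s]")
     auto

definition gauss_jordan :: "(nat \<Rightarrow> nat \<Rightarrow>\<^sub>0 'a::field) \<Rightarrow> nat \<Rightarrow> nat \<Rightarrow> (nat \<Rightarrow>\<^sub>0 'a)" where
  "gauss_jordan C n k = gj_aux C (Suc n) k"  \<comment> \<open>\<open>L\<^sup>(\<^sup>n\<^sup>)\<^sub>k\<close>\<close>

end

theory Submission
  imports Defs
begin

text \<open>
  The rows of each stage are in reduced form: every nonzero row has the entry \<open>1\<close> at its
  pivot, and every other row vanishes there (\<open>stage_reduced\<close>). Consequently the pivot of a new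
  row avoids all earlier pivots, and the Jordan step that it triggers never moves an earlier
  pivot: if the new pivot lies to the right of that of row \<open>k\<close>, then row \<open>k\<close> has a zero entry
  there and does not change at all; if it lies to the left, only entries left of the pivot
  of row \<open>k\<close> change. So each nonzero row keeps for ever the pivot it gets at its
  creation, and different nonzero rows have different pivots (\<open>inj_on_created_pivots\<close>).

  Row \<open>k\<close> can therefore change in stage \<open>n\<close> only if the pivot of the row created in that stage
  is one of the finitely many positions to the left of the pivot of row \<open>k\<close>. Distinct
  stages use distinct positions, so there are only finitely many such stages. Rightmost
  pivots are essential in this count, since there are infinitely many positions on the other
  side.
\<close>

lemma lookup_pivot_nonzero:
  assumes "x \<noteq> 0"
  shows "Poly_Mapping.lookup x (pivot x) \<noteq> 0"
proof -
  have "pivot x = Max (Poly_Mapping.keys x)"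
    using assms by (simp add: pivot_def row_length_def)
  moreover have "Max (Poly_Mapping.keys x) \<in> Poly_Mapping.keys x"
    using assms by (intro Max_in) auto
  ultimately show ?thesis
    by (simp add: in_keys_iff)
qed

lemma lookup_beyond_pivot:
  assumes "pivot x < m"
  shows "Poly_Mapping.lookup x m = 0"
proof (rule ccontr)
  assume "Poly_Mapping.lookup x m \<noteq> 0"
  then have "m \<in> Poly_Mapping.keys x" and "x \<noteq> 0"
    by (auto simp: in_keys_iff)
  then have "m \<le> pivot x"
    by (simp add: pivot_def row_length_def)
  with assms show False by simp
qed

lemma pivot_eqI:
  assumes "Poly_Mapping.lookup x m \<noteq> 0"
    and "\<And>j. m < j \<Longrightarrow> Poly_Mapping.lookup x j = 0"
  shows "pivot x = m"
proof -
  have "x \<noteq> 0" using assms(1) by auto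
  then have "Poly_Mapping.lookup x (pivot x) \<noteq> 0" by (rule lookup_pivot_nonzero)
  then have "\<not> m < pivot x" using assms(2) by blast
  moreover have "\<not> pivot x < m" using assms(1) lookup_beyond_pivot by blast
  ultimately show ?thesis by simp
qed

lemma lookup_scale [simp]:
  "Poly_Mapping.lookup (scale c x) m = c * Poly_Mapping.lookup x m"
  by (simp add: scale_def Poly_Mapping.map.rep_eq when_def)

text \<open>No case distinction on \<open>p = 0\<close> is left: a zero row contributes zero entries.\<close>

lemma lookup_clear_pivot [simp]:
  "Poly_Mapping.lookup (clear_pivot p x) m =
     Poly_Mapping.lookup x m - Poly_Mapping.lookup x (pivot p) * Poly_Mapping.lookup p m"
  by (simp add: clear_pivot_def lookup_minus)

lemma clear_pivot_zero [simp]: "clear_pivot p 0 = 0"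
  by (rule poly_mapping_eqI) simp

lemma lookup_normalize_row:
  "Poly_Mapping.lookup (normalize_row x) m =
     inverse (Poly_Mapping.lookup x (pivot x)) * Poly_Mapping.lookup x m"
  by (simp add: normalize_row_def)

lemma normalize_row_eq_0_iff [simp]: "normalize_row x = 0 \<longleftrightarrow> x = 0"
proof
  assume "normalize_row x = 0"
  then have "Poly_Mapping.lookup (normalize_row x) (pivot x) = 0" by simp
  then show "x = 0" using lookup_pivot_nonzero[of x] by (auto simp: lookup_normalize_row)
qed (simp add: normalize_row_def)

lemma pivot_normalize_row:
  assumes "x \<noteq> 0"
  shows "pivot (normalize_row x) = pivot x"
  using lookup_pivot_nonzero[OF assms]
  by (intro pivot_eqI) (auto simp: lookup_normalize_row lookup_beyond_pivot)

lemma lookup_normalize_row_pivot: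
  assumes "x \<noteq> 0"
  shows "Poly_Mapping.lookup (normalize_row x) (pivot (normalize_row x)) = 1"
  using lookup_pivot_nonzero[OF assms]
  by (simp add: pivot_normalize_row[OF assms] lookup_normalize_row)

lemma clear_pivot_right_of_pivot:
  assumes "pivot x < pivot p"
  shows "clear_pivot p x = x"
  by (rule poly_mapping_eqI) (simp add: lookup_beyond_pivot[OF assms])

text \<open>A nonzero row \<open>p\<close> that vanishes at the pivot of \<open>x\<close> either has its own pivot further right, where \<open>x\<close>
  has no entry to clear, or further left, where clearing cannot reach the pivot of \<open>x\<close>.\<close>

lemma clear_pivot_preserves_pivot:
  assumes "x \<noteq> 0" and "Poly_Mapping.lookup p (pivot x) = 0"
  shows "pivot (clear_pivot p x) = pivot x" and "clear_pivot p x \<noteq> 0"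
proof -
  have at_pivot: "Poly_Mapping.lookup (clear_pivot p x) (pivot x) \<noteq> 0"
    using assms lookup_pivot_nonzero[of x] by simp
  then show "clear_pivot p x \<noteq> 0" by (metis lookup_zero)
  show "pivot (clear_pivot p x) = pivot x"
  proof (cases "pivot x < pivot p")
    case True
    then show ?thesis by (simp add: clear_pivot_right_of_pivot)
  next
    case False
    with at_pivot show ?thesis
      by (intro pivot_eqI) (auto simp: lookup_beyond_pivot)
  qed
qed

text \<open>Zero rows carry no pivot and are exempt; the junk value \<open>pivot 0 = 0\<close> must not
  force any entry to vanish.\<close>

definition reduced_rows :: "nat \<Rightarrow> (nat \<Rightarrow> (nat \<Rightarrow>\<^sub>0 'a::field)) \<Rightarrow> bool" where
  "reduced_rows n R \<longleftrightarrow>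
     (\<forall>j<n. R j \<noteq> 0 \<longrightarrow>
        (\<forall>i<n. Poly_Mapping.lookup (R i) (pivot (R j)) = (if i = j then 1 else 0)))"

lemma reduced_rowsD:
  assumes "reduced_rows n R" and "i < n" and "j < n" and "R j \<noteq> 0"
  shows "Poly_Mapping.lookup (R i) (pivot (R j)) = (if i = j then 1 else 0)"
  using assms by (auto simp: reduced_rows_def)

text \<open>Gaussian elimination against reduced rows never undoes what it has cleared: row \<open>i\<close> vanishes
  at the pivots of the rows before it.\<close>

lemma gaussian_elimination_clears:
  assumes "reduced_rows n (gj_aux C n)" and "i \<le> n" and "j < i" and "gj_aux C n j \<noteq> 0"
  shows "Poly_Mapping.lookup (gj_aux C i n) (pivot (gj_aux C n j)) = 0"
  using assms(2,3)
proof (induction i)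
  case (Suc i)
  then show ?case
    using reduced_rowsD[OF assms(1), of i j] assms(4) by (cases "j = i") auto
qed simp

lemma created_row_avoids_earlier_pivots:
  assumes "reduced_rows n (gj_aux C n)" and "j < n" and "gj_aux C n j \<noteq> 0"
  shows "Poly_Mapping.lookup (gj_aux C (Suc n) n) (pivot (gj_aux C n j)) = 0"
  using gaussian_elimination_clears[OF assms(1) order_refl assms(2,3)]
  by (simp add: lookup_normalize_row)

lemma gj_aux_jordan_step:
  assumes "k < n"
  shows "gj_aux C (Suc n) k = clear_pivot (gj_aux C (Suc n) n) (gj_aux C n k)"
  using assms by simp

text \<open>The default equation would unfold the created row into elimination and normalization;
  all that matters about that row is stated by the lemmas here.\<close>

declare gj_aux.simps(2) [simp del]

lemma lookup_created_row_pivot: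
  assumes "gj_aux C (Suc n) n \<noteq> 0"
  shows "Poly_Mapping.lookup (gj_aux C (Suc n) n) (pivot (gj_aux C (Suc n) n)) = 1"
  using assms lookup_normalize_row_pivot[of "gj_aux C n n"] by (simp add: gj_aux.simps(2))

lemma jordan_step_pivot:
  assumes "reduced_rows n (gj_aux C n)" and "j < n"
  shows "gj_aux C (Suc n) j = 0 \<longleftrightarrow> gj_aux C n j = 0"
    and "gj_aux C n j \<noteq> 0 \<Longrightarrow> pivot (gj_aux C (Suc n) j) = pivot (gj_aux C n j)"
  using clear_pivot_preserves_pivot[OF _ created_row_avoids_earlier_pivots[OF assms]]
  by (cases "gj_aux C n j = 0"; simp add: gj_aux_jordan_step[OF assms(2)])+

text \<open>Jordan elimination clears the column of the new pivot and, since the created row vanishes at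
  the old pivots, leaves the old pivot columns as they are.\<close>

lemma stage_reduced: "reduced_rows n (gj_aux C n)"
proof (induction n)
  case 0
  show ?case by (simp add: reduced_rows_def)
next
  case (Suc n)
  let ?G = "gj_aux C (Suc n) n"
  show ?case
    unfolding reduced_rows_def
  proof (intro allI impI)
    fix j i
    assume j: "j < Suc n" and nz: "gj_aux C (Suc n) j \<noteq> 0" and i: "i < Suc n"
    show "Poly_Mapping.lookup (gj_aux C (Suc n) i) (pivot (gj_aux C (Suc n) j)) =
            (if i = j then 1 else 0)"
    proof (cases "j = n")
      case True
      with nz have "Poly_Mapping.lookup ?G (pivot ?G) = 1"
        by (simp add: lookup_created_row_pivot)
      with True i show ?thesis
        by (cases "i = n") (auto simp: gj_aux_jordan_step)
    next
      case False
      with j have "j < n" by simp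
      with nz have old: "gj_aux C n j \<noteq> 0"
        and same: "pivot (gj_aux C (Suc n) j) = pivot (gj_aux C n j)"
        using jordan_step_pivot[OF Suc.IH] by auto
      have "Poly_Mapping.lookup ?G (pivot (gj_aux C n j)) = 0"
        by (rule created_row_avoids_earlier_pivots[OF Suc.IH \<open>j < n\<close> old])
      then show ?thesis
        unfolding same
        using i \<open>j < n\<close> reduced_rowsD[OF Suc.IH _ \<open>j < n\<close> old, of i]
        by (cases "i = n") (auto simp: gj_aux_jordan_step)
    qed
  qed
qed

lemma created_pivot_persists:
  assumes "k < n"
  shows "(gj_aux C n k = 0 \<longleftrightarrow> gj_aux C (Suc k) k = 0) \<and>
     (gj_aux C (Suc k) k \<noteq> 0 \<longrightarrow> pivot (gj_aux C n k) = pivot (gj_aux C (Suc k) k))"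
proof -
  have "Suc k \<le> n" using assms by simp
  then show ?thesis
    by (induction n rule: dec_induct) (auto simp: jordan_step_pivot[OF stage_reduced])
qed

text \<open>At the creation of the later of two rows, the earlier one still has its original pivot, and
  the later one vanishes there.\<close>

lemma inj_on_created_pivots:
  "inj_on (\<lambda>n. pivot (gj_aux C (Suc n) n)) {n. gj_aux C (Suc n) n \<noteq> 0}"
proof (rule linorder_inj_onI)
  fix m n
  assume "m < n" and m: "m \<in> {n. gj_aux C (Suc n) n \<noteq> 0}"
    and n: "n \<in> {n. gj_aux C (Suc n) n \<noteq> 0}"
  have "Poly_Mapping.lookup (gj_aux C (Suc n) n) (pivot (gj_aux C (Suc m) m)) = 0"
    using created_row_avoids_earlier_pivots[OF stage_reduced \<open>m < n\<close>, of C]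
      created_pivot_persists[OF \<open>m < n\<close>, of C] m by simp
  then show "pivot (gj_aux C (Suc m) m) \<noteq> pivot (gj_aux C (Suc n) n)"
    using n lookup_pivot_nonzero[of "gj_aux C (Suc n) n"] by auto
qed auto

lemma row_changes_only_for_left_pivot:
  assumes "k < n" and "gj_aux C (Suc n) k \<noteq> gj_aux C n k"
  shows "gj_aux C (Suc n) n \<noteq> 0"
    and "pivot (gj_aux C (Suc n) n) < pivot (gj_aux C (Suc k) k)"
proof -
  let ?G = "gj_aux C (Suc n) n" and ?x = "gj_aux C n k"
  have change: "clear_pivot ?G ?x \<noteq> ?x"
    using assms by (simp add: gj_aux_jordan_step)
  then show G: "?G \<noteq> 0"
    by (auto simp: clear_pivot_def)
  have x: "?x \<noteq> 0" using change by auto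
  then have created: "gj_aux C (Suc k) k \<noteq> 0"
    and same: "pivot ?x = pivot (gj_aux C (Suc k) k)"
    using created_pivot_persists[OF assms(1), of C] by auto
  have "pivot ?G \<noteq> pivot (gj_aux C (Suc k) k)"
    using inj_on_created_pivots[of C] G created assms(1) by (auto dest!: inj_onD)
  moreover have "\<not> pivot ?x < pivot ?G"
    using change clear_pivot_right_of_pivot by blast
  ultimately show "pivot ?G < pivot (gj_aux C (Suc k) k)"
    using same by simp
qed

lemma finitely_many_row_changes:
  "finite {n. k < n \<and> gj_aux C (Suc n) k \<noteq> gj_aux C n k}"
proof (rule inj_on_finite)
  let ?S = "{n. k < n \<and> gj_aux C (Suc n) k \<noteq> gj_aux C n k}"
  let ?piv = "\<lambda>n. pivot (gj_aux C (Suc n) n)"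
  show "inj_on ?piv ?S"
    using row_changes_only_for_left_pivot(1)
    by (intro inj_on_subset[OF inj_on_created_pivots]) blast
  show "?piv ` ?S \<subseteq> {..<pivot (gj_aux C (Suc k) k)}"
    using row_changes_only_for_left_pivot(2) by blast
qed simp

theorem theorem32:
  fixes C :: "nat \<Rightarrow> (nat \<Rightarrow>\<^sub>0 'a::field)"
  shows "\<forall>k. \<exists>M\<ge>k. \<forall>n>M. gauss_jordan C n k = gauss_jordan C M k"
proof
  fix k
  let ?S = "{n. k < n \<and> gj_aux C (Suc n) k \<noteq> gj_aux C n k}"
  obtain b where b: "\<forall>n\<in>?S. n \<le> b"
    using finitely_many_row_changes[of k C] finite_nat_set_iff_bounded_le by blast
  define M where "M = max k b"
  have "gauss_jordan C n k = gauss_jordan C M k" if "n > M" for n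
  proof -
    have "M \<le> n" using that by simp
    then show ?thesis
    proof (induction n rule: dec_induct)
      case (step n)
      \<comment> \<open>this step is stage \<open>Suc n\<close>, which lies beyond both \<open>k\<close> and the last change\<close>
      have "\<not> Suc n \<le> b" using step.hyps by (simp add: M_def)
      then have "Suc n \<notin> ?S" using b by blast
      then have "gj_aux C (Suc (Suc n)) k = gj_aux C (Suc n) k"
        using step.hyps by (simp add: M_def)
      then show ?case using step.IH by (simp add: gauss_jordan_def)
    qed simp
  qed
  then show "\<exists>M\<ge>k. \<forall>n>M. gauss_jordan C n k = gauss_jordan C M k"
    by (intro exI[of _ M]) (auto simp: M_def)
qed

end
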